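(* Let $P_4$ denote the path on $4$ vertices. Then $\mathrm{rb}(n,P_4,P_4)=n-3$ if $n\ge 5$, $\mathrm{rb}(4,P_4,P_4)=2$, and $\mathrm{rb}(n,P_4,P_4)=0$ if $n\le 3$.
   Context: All graphs are finite and simple. A copy of $H$ in a graph $G$ is a (not necessarily induced) subgraph of $G$ isomorphic to $H$. Given a graph $G$ and a family $\mathcal{H}$ of subgraphs of $G$, a subgraph $F$ of $G$ is called rainbow if there is an injection $\phi:E(F)\to\mathcal{H}$ such that each edge $e\in E(F)$ is an edge of $\phi(e)$. For graphs $H,F$ and a positive integer $n$, $\mathrm{rb}(n,H,F)$ denotes the largest cardinality of a family $\mathcal{H}$ of distinct copies of $H$ in an $n$-vertex graph $G$ such that no copy of $F$ in $G$ is rainbow (the maximum is over all $n$-vertex graphs $G$ and all such families). *)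

theory Defs
  imports Main
begin

record 'a sgraph =
  verts :: "'a set"
  edges :: "'a set set"

definition simple_graph :: "'a sgraph \<Rightarrow> bool" where
  "simple_graph G \<longleftrightarrow> finite (verts G) \<and> (\<forall>e \<in> edges G. e \<subseteq> verts G \<and> card e = 2)"

definition subgraph :: "'a sgraph \<Rightarrow> 'a sgraph \<Rightarrow> bool" where
  "subgraph F G \<longleftrightarrow> simple_graph F \<and> verts F \<subseteq> verts G \<and> edges F \<subseteq> edges G"

definition isomorphic :: "'a sgraph \<Rightarrow> 'b sgraph \<Rightarrow> bool" where
  "isomorphic G H \<longleftrightarrow>
     (\<exists>f. bij_betw f (verts G) (verts H) \<and>
          (\<forall>x \<in> verts G. \<forall>y \<in> verts G. {x, y} \<in> edges G \<longleftrightarrow> {f x, f y} \<in> edges H))"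

definition copies :: "'b sgraph \<Rightarrow> 'a sgraph \<Rightarrow> 'a sgraph set" where
  "copies H G = {C. subgraph C G \<and> isomorphic H C}"

definition rainbow :: "'a sgraph set \<Rightarrow> 'a sgraph \<Rightarrow> bool" where
  "rainbow \<H> F \<longleftrightarrow>
     (\<exists>\<phi>. inj_on \<phi> (edges F) \<and> (\<forall>e \<in> edges F. \<phi> e \<in> \<H> \<and> e \<in> edges (\<phi> e)))"

text \<open>The host graphs range over the graphs with \<open>n\<close> vertices among the natural numbers; every
  finite graph is isomorphic to one of these. The set below is finite, and it is nonempty as soon
  as \<open>F\<close> has an edge (see below), so that its maximum is meaningful.\<close>

definition rb_sizes :: "nat \<Rightarrow> 'a sgraph \<Rightarrow> 'b sgraph \<Rightarrow> nat set" where
  "rb_sizes n H F =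
     {card \<H> | \<H> (G :: nat sgraph).
        simple_graph G \<and> card (verts G) = n \<and> \<H> \<subseteq> copies H G \<and>
        (\<forall>C \<in> copies F G. \<not> rainbow \<H> C)}"

definition rb :: "nat \<Rightarrow> 'a sgraph \<Rightarrow> 'b sgraph \<Rightarrow> nat" where
  "rb n H F = Max (rb_sizes n H F)"

definition path_graph :: "nat \<Rightarrow> nat sgraph" where
  "path_graph k = \<lparr>verts = {..<k}, edges = {{i, Suc i} | i. Suc i < k}\<rparr>"

lemma finite_rb_sizes: "finite (rb_sizes n H F)"
proof -
  have "card \<H> \<le> 2 ^ n * 2 ^ (2 ^ n)"
    if G: "simple_graph G" "card (verts G) = n" and sub: "\<H> \<subseteq> copies H G"
    for \<H> and G :: "nat sgraph"
  proof -
    let ?p = "\<lambda>C :: nat sgraph. (verts C, edges C)"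
    let ?B = "Pow (verts G) \<times> Pow (Pow (verts G))"
    have fin: "finite (verts G)"
      using G by (simp add: simple_graph_def)
    have "?p ` \<H> \<subseteq> ?B"
      using sub by (fastforce simp: copies_def subgraph_def simple_graph_def)
    moreover have "inj_on ?p \<H>"
      by (auto intro!: inj_onI sgraph.equality)
    ultimately have "card \<H> \<le> card ?B"
      using fin by (intro card_inj_on_le) auto
    also have "\<dots> = 2 ^ n * 2 ^ (2 ^ n)"
      using G fin by (simp add: card_cartesian_product card_Pow)
    finally show ?thesis .
  qed
  then have "rb_sizes n H F \<subseteq> {.. 2 ^ n * 2 ^ (2 ^ n)}"
    unfolding rb_sizes_def by blast
  then show ?thesis
    by (rule finite_subset) simp
qed

lemma rb_sizes_nonempty:
  assumes "simple_graph F" "edges F \<noteq> {}"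
  shows "rb_sizes n H F \<noteq> {}"
proof -
  let ?G = "\<lparr>verts = {..<n}, edges = {}\<rparr> :: nat sgraph"
  obtain e where e: "e \<in> edges F" "card e = 2" "e \<subseteq> verts F"
    using assms by (auto simp: simple_graph_def)
  then obtain x y where "e = {x, y}"
    by (auto simp: card_2_iff)
  then have "copies F ?G = {}"
    using e by (auto simp: copies_def subgraph_def isomorphic_def)
  then have "card ({} :: nat sgraph set) \<in> rb_sizes n H F"
    unfolding rb_sizes_def
    by (intro CollectI exI[of _ "{}"] exI[of _ ?G]) (auto simp: simple_graph_def)
  then show ?thesis
    by blast
qed

end

theory Submission
  imports Defs
begin

text \<open>Upper bound: let at least three copies of \<open>P\<^sub>4\<close> have no rainbow \<open>P\<^sub>4\<close>. Each copy has an edge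
  lying in no other copy (else it would be rainbow itself), so choosing one such edge per copy gives
  a graph in which every \<open>P\<^sub>4\<close> would be rainbow. It has no triangle either and is therefore a star
  forest; its edges correspond to its leaves, and it remains to find three further vertices. If
  there is only one star, with centre \<open>y\<close>, a copy meets it only in \<open>y\<close> and its own leaf, so its other
  two vertices and \<open>y\<close> will do. If there are several stars and only two further vertices, these are
  the centres \<open>y\<close> and \<open>z\<close> of two spanning stars, and following a copy that owns a leaf of the larger
  star produces a rainbow \<open>P\<^sub>4\<close> in every case.

  Lower bound: the paths \<open>2, 0, i, 1\<close> for \<open>3 \<le> i < n\<close>.\<close>

section \<open>Four-vertex paths in explicit coordinates\<close>

definition path4 :: "'a \<Rightarrow> 'a \<Rightarrow> 'a \<Rightarrow> 'a \<Rightarrow> 'a sgraph" where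
  "path4 a b c d = \<lparr>verts = {a, b, c, d}, edges = {{a, b}, {b, c}, {c, d}}\<rparr>"

lemma path4_sel [simp]:
  "verts (path4 a b c d) = {a, b, c, d}"
  "edges (path4 a b c d) = {{a, b}, {b, c}, {c, d}}"
  by (simp_all add: path4_def)

lemma lessThan_4: "{..<4::nat} = {0, 1, 2, 3}"
  by auto

lemma path_graph_4: "path_graph 4 = path4 0 1 2 3"
proof -
  have "{{i, Suc i} | i. Suc i < 4} = (\<lambda>i. {i, Suc i}) ` {0, 1, 2}"
    by (auto simp: image_def numeral_eq_Suc less_Suc_eq)
  also have "\<dots> = {{0, 1}, {1, 2}, {2, 3}}"
    by (simp add: numeral_eq_Suc)
  finally show ?thesis
    by (simp add: path_graph_def path4_def lessThan_4)
qed

lemma isomorphic_path4: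
  assumes "distinct [a, b, c, d]"
  shows "isomorphic (path_graph 4) (path4 a b c d)"
proof -
  define f where "f i = (if i = 0 then a else if i = 1 then b else if i = 2 then c else d)"
    for i :: nat
  have "bij_betw f (verts (path_graph 4)) (verts (path4 a b c d))"
    using assms by (auto simp: bij_betw_def path_graph_4 f_def)
  moreover have "\<forall>x \<in> verts (path_graph 4). \<forall>y \<in> verts (path_graph 4).
      {x, y} \<in> edges (path_graph 4) \<longleftrightarrow> {f x, f y} \<in> edges (path4 a b c d)"
    using assms by (auto simp: path_graph_4 f_def doubleton_eq_iff)
  ultimately show ?thesis
    unfolding isomorphic_def by blast
qed

lemma copies_path4E:
  assumes "C \<in> copies (path_graph 4) G"
  obtains a b c d where "distinct [a, b, c, d]" "C = path4 a b c d"
proof -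
  have sg: "simple_graph C" and "isomorphic (path_graph 4) C"
    using assms by (auto simp: copies_def subgraph_def)
  then obtain f where f: "bij_betw f {0, 1, 2, 3 :: nat} (verts C)"
    and e: "\<forall>x \<in> {0, 1, 2, 3}. \<forall>y \<in> {0, 1, 2, 3}.
      {x, y} \<in> {{0, 1}, {1, 2}, {2, 3}} \<longleftrightarrow> {f x, f y} \<in> edges C"
    unfolding isomorphic_def path_graph_4 path4_sel by blast
  have V: "verts C = {f 0, f 1, f 2, f 3}" and inj: "inj_on f {0, 1, 2, 3}"
    using f by (auto simp: bij_betw_def)
  have dist: "distinct [f 0, f 1, f 2, f 3]"
    using inj by (auto simp: inj_on_def)
  have "edges C = {{f 0, f 1}, {f 1, f 2}, {f 2, f 3}}"
  proof (intro equalityI subsetI)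
    \<comment> \<open>Simplicity of \<open>C\<close> makes each edge a pair of images under
      \<open>f\<close>, so the isomorphism condition on pairs determines all of
      \<open>edges C\<close>.\<close>
    fix s assume s: "s \<in> edges C"
    then have "s \<subseteq> verts C" "card s = 2"
      using sg by (auto simp: simple_graph_def)
    then obtain p q where "s = {p, q}" "p \<in> f ` {0, 1, 2, 3}" "q \<in> f ` {0, 1, 2, 3}"
      using f by (auto simp: card_2_iff bij_betw_def simp del: image_insert)
    then obtain x y where xy: "x \<in> {0, 1, 2, 3}" "y \<in> {0, 1, 2, 3}" "s = {f x, f y}"
      by blast
    have "{x, y} \<in> {{0, 1}, {1, 2}, {2, 3}}"
      by (rule iffD2[OF bspec[OF bspec[OF e xy(1)] xy(2)] s[unfolded xy(3)]])
    then show "s \<in> {{f 0, f 1}, {f 1, f 2}, {f 2, f 3}}"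
      unfolding xy(3) by (auto simp: doubleton_eq_iff)
  next
    fix s assume "s \<in> {{f 0, f 1}, {f 1, f 2}, {f 2, f 3}}"
    moreover have "{f 0, f 1} \<in> edges C" "{f 1, f 2} \<in> edges C" "{f 2, f 3} \<in> edges C"
      using e by simp_all
    ultimately show "s \<in> edges C"
      by auto
  qed
  then have "C = path4 (f 0) (f 1) (f 2) (f 3)"
    by (simp add: V path4_def)
  with dist show ?thesis
    using that by blast
qed

lemma path4_in_copies:
  assumes "distinct [a, b, c, d]" "{a, b, c, d} \<subseteq> verts G"
    and "{{a, b}, {b, c}, {c, d}} \<subseteq> edges G"
  shows "path4 a b c d \<in> copies (path_graph 4) G"
  using assms isomorphic_path4[OF assms(1)]
  by (auto simp: copies_def subgraph_def simple_graph_def card_2_iff)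

lemma rainbow_path4I:
  assumes "distinct [a, b, c, d]" "distinct [A, B, C]" "{A, B, C} \<subseteq> \<H>"
    and "{a, b} \<in> edges A" "{b, c} \<in> edges B" "{c, d} \<in> edges C"
  shows "rainbow \<H> (path4 a b c d)"
  unfolding rainbow_def
  using assms
  by (intro exI[of _ "\<lambda>e. if e = {a, b} then A else if e = {b, c} then B else C"])
     (auto simp: inj_on_def doubleton_eq_iff)

lemma rainbow_path4E:
  assumes "rainbow \<H> (path4 a b c d)" "distinct [a, b, c, d]"
  obtains A B C where "distinct [A, B, C]" "{A, B, C} \<subseteq> \<H>"
    "{a, b} \<in> edges A" "{b, c} \<in> edges B" "{c, d} \<in> edges C"
proof -
  obtain \<phi> where \<phi>: "inj_on \<phi> {{a, b}, {b, c}, {c, d}}"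
    "\<forall>e \<in> {{a, b}, {b, c}, {c, d}}. \<phi> e \<in> \<H> \<and> e \<in> edges (\<phi> e)"
    using assms(1) by (auto simp: rainbow_def)
  have "distinct [{a, b}, {b, c}, {c, d}]"
    using assms(2) by (auto simp: doubleton_eq_iff)
  then have "distinct [\<phi> {a, b}, \<phi> {b, c}, \<phi> {c, d}]"
    using \<phi>(1) by (auto simp: inj_on_def)
  then show ?thesis
    using \<phi>(2) by (intro that) auto
qed

section \<open>Rainbow-free families and their exclusive edges\<close>

text \<open>The host graph is left out: it contains every edge of every member, so a path with edges
  from three different members is automatically a copy in it.\<close>

locale rainbow_free_path4s =
  fixes \<H> :: "'a sgraph set"
  assumes finite_family: "finite \<H>"
    and ex_path4: "P \<in> \<H> \<Longrightarrow> \<exists>a b c d. distinct [a, b, c, d] \<and> P = path4 a b c d"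
    and no_rainbow: "\<lbrakk>A \<in> \<H>; B \<in> \<H>; C \<in> \<H>; distinct [A, B, C]; distinct [a, b, c, d];
      {a, b} \<in> edges A; {b, c} \<in> edges B; {c, d} \<in> edges C\<rbrakk> \<Longrightarrow> False"
begin

lemma edge_neq: "\<lbrakk>P \<in> \<H>; {x, y} \<in> edges P\<rbrakk> \<Longrightarrow> x \<noteq> y"
  using ex_path4[of P] by (auto simp: doubleton_eq_iff)

lemma edge_verts: "\<lbrakk>P \<in> \<H>; {x, y} \<in> edges P\<rbrakk> \<Longrightarrow> x \<in> verts P \<and> y \<in> verts P"
  using ex_path4[of P] by (auto simp: doubleton_eq_iff)

lemma vertex_edge: "\<lbrakk>P \<in> \<H>; x \<in> verts P\<rbrakk> \<Longrightarrow> \<exists>y. {x, y} \<in> edges P"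
  using ex_path4[of P] by (auto simp: doubleton_eq_iff)

lemma adjacent_edge:
  assumes "P \<in> \<H>" "{x, y} \<in> edges P"
  obtains v where "v \<noteq> x" "v \<noteq> y" "{x, v} \<in> edges P \<or> {y, v} \<in> edges P"
proof -
  have "\<exists>v. v \<noteq> x \<and> v \<noteq> y \<and> ({x, v} \<in> edges P \<or> {y, v} \<in> edges P)"
    using assms ex_path4[of P] by (auto simp: doubleton_eq_iff)
  then show ?thesis using that by blast
qed

text \<open>Inner vertices of a path have two neighbours, so \<open>y\<close> is an end and the path
  can be read off from there.\<close>

lemma end_edge_extends:
  assumes "P \<in> \<H>" "{y, u} \<in> edges P" "\<And>w. {y, w} \<in> edges P \<Longrightarrow> w = u"
  obtains w x where "distinct [y, u, w, x]" "{u, w} \<in> edges P" "{w, x} \<in> edges P"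
proof -
  obtain a b c d where d: "distinct [a, b, c, d]" and P: "P = path4 a b c d"
    using ex_path4 assms(1) by blast
  have ed: "{a, b} \<in> edges P" "{b, c} \<in> edges P" "{c, d} \<in> edges P"
    "{b, a} \<in> edges P" "{c, b} \<in> edges P" "{d, c} \<in> edges P"
    by (auto simp: P)
  have "(y = a \<and> u = b) \<or> (y = d \<and> u = c)"
    using assms(2) assms(3)[of a] assms(3)[of b] assms(3)[of c] assms(3)[of d] ed d
    by (auto simp: P doubleton_eq_iff)
  then show ?thesis
    using that[of c d] that[of b a] d ed by auto
qed

text \<open>If every edge of \<open>P\<close> lay in another member, these members would coincide:
  two different ones on adjacent edges, with \<open>P\<close> itself on the remaining edge, would
  make \<open>P\<close> rainbow. A single other member would then contain all three edges of
  \<open>P\<close>.\<close>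

lemma ex_exclusive_edge:
  assumes "P \<in> \<H>"
  shows "\<exists>e \<in> edges P. \<forall>Q \<in> \<H>. Q \<noteq> P \<longrightarrow> e \<notin> edges Q"
proof (rule ccontr)
  assume no: "\<not> ?thesis"
  obtain a b c d where d: "distinct [a, b, c, d]" and P: "P = path4 a b c d"
    using ex_path4 assms by blast
  obtain A where A: "A \<in> \<H>" "A \<noteq> P" "{a, b} \<in> edges A"
    using no by (auto simp: P)
  obtain B where B: "B \<in> \<H>" "B \<noteq> P" "{b, c} \<in> edges B"
    using no by (auto simp: P)
  obtain C where C: "C \<in> \<H>" "C \<noteq> P" "{c, d} \<in> edges C"
    using no by (auto simp: P)
  have "A = B"
    using no_rainbow[of A B P a b c d] A B d assms by (auto simp: P)
  moreover have "B = C"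
    using no_rainbow[of P B C a b c d] C B d assms by (auto simp: P)
  ultimately have sub: "edges P \<subseteq> edges A"
    using A B C by (auto simp: P)
  \<comment> \<open>Equal size turns the inclusion of edge sets into equality, and without isolated
    vertices the edges determine the whole graph.\<close>
  have "card (edges X) = 3 \<and> finite (edges X) \<and> verts X = \<Union> (edges X)" if "X \<in> \<H>" for X
    using ex_path4[OF that] by (auto simp: doubleton_eq_iff card_insert_if)
  then have "edges P = edges A" "verts P = verts A"
    using sub A(1) assms by (metis card_subset_eq)+
  then have "P = A"
    by (simp add: sgraph.equality)
  then show False using A by simp
qed

definition excl :: "'a sgraph \<Rightarrow> 'a \<Rightarrow> 'a \<Rightarrow> bool" where
  "excl P x y \<longleftrightarrow> {x, y} \<in> edges P \<and> (\<forall>Q \<in> \<H>. {x, y} \<in> edges Q \<longrightarrow> Q = P)"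

lemma exclD: "excl P x y \<Longrightarrow> {x, y} \<in> edges P" "excl P x y \<Longrightarrow> {y, x} \<in> edges P"
  by (simp_all add: excl_def insert_commute)

lemma excl_unique: "\<lbrakk>excl P x y; Q \<in> \<H>; {x, y} \<in> edges Q \<or> {y, x} \<in> edges Q\<rbrakk> \<Longrightarrow> Q = P"
  by (auto simp: excl_def insert_commute)

text \<open>Here \<open>{c P, l P}\<close> is an exclusive edge of \<open>P\<close>, with centre \<open>c P\<close> and leaf \<open>l P\<close> in the star
  forest formed by these edges (either end of an isolated edge may serve as its leaf).\<close>

lemma ex_leaf_center:
  "\<exists>c l. (\<forall>P \<in> \<H>. excl P (c P) (l P)) \<and> inj_on l \<H> \<and> (\<forall>P \<in> \<H>. \<forall>Q \<in> \<H>. c P \<noteq> l Q)"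
proof -
  have "\<forall>P \<in> \<H>. \<exists>e. e \<in> edges P \<and> (\<forall>Q \<in> \<H>. e \<in> edges Q \<longrightarrow> Q = P)"
    using ex_exclusive_edge by blast
  then obtain t where t: "\<And>P. P \<in> \<H> \<Longrightarrow> t P \<in> edges P"
      "\<And>P Q. \<lbrakk>P \<in> \<H>; Q \<in> \<H>; t P \<in> edges Q\<rbrakk> \<Longrightarrow> Q = P"
    by metis
  have ends: "\<exists>x y. t P = {x, y} \<and> x \<noteq> y" if P: "P \<in> \<H>" for P
  proof -
    obtain a b c d where "distinct [a, b, c, d]" "P = path4 a b c d"
      using ex_path4[OF P] by blast
    moreover from this have "t P = {a, b} \<or> t P = {b, c} \<or> t P = {c, d}"
      using t(1)[OF P] by simp
    ultimately show ?thesis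
      by (metis distinct_length_2_or_more)
  qed
  have other_end: "\<exists>y. t P = {x, y} \<and> x \<noteq> y" if "P \<in> \<H>" "x \<in> t P" for P x
    using ends[OF that(1)] that(2) by (metis insertE insert_commute singletonD)
  \<comment> \<open>A chosen edge with further chosen edges at both ends would be the middle of a
    rainbow path or a side of a triangle. The end that it keeps to itself becomes the leaf.\<close>
  have private_end: "\<exists>x y. t P = {x, y} \<and> x \<noteq> y \<and> (\<forall>Q \<in> \<H>. Q \<noteq> P \<longrightarrow> y \<notin> t Q)"
    if P: "P \<in> \<H>" for P
  proof (rule ccontr)
    assume no: "\<not> ?thesis"
    obtain x y where xy: "t P = {x, y}" "x \<noteq> y"
      using ends P by blast
    obtain Q where Q: "Q \<in> \<H>" "Q \<noteq> P" "x \<in> t Q"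
      using no xy by (metis insert_commute)
    obtain R where R: "R \<in> \<H>" "R \<noteq> P" "y \<in> t R"
      using no xy by metis
    obtain x' where x': "t Q = {x, x'}" "x \<noteq> x'"
      using other_end Q by blast
    obtain y' where y': "t R = {y, y'}" "y \<noteq> y'"
      using other_end R by blast
    have "t Q \<noteq> t P" "t R \<noteq> t P"
      using t P Q R by metis+
    then have ne: "x' \<noteq> y" "y' \<noteq> x"
      using xy x' y' by (auto simp: insert_commute)
    then have QR: "Q \<noteq> R"
      using xy x' y' by (auto simp: doubleton_eq_iff)
    have e: "{x, y} \<in> edges P" "{y, x} \<in> edges P" "{x', x} \<in> edges Q" "{x, x'} \<in> edges Q"
      "{y, y'} \<in> edges R" "{y', y} \<in> edges R"
      using t(1) P Q R xy x' y' by (metis insert_commute)+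
    show False
    proof (cases "x' = y'")
      case False
      then show False
        using no_rainbow[of Q P R x' x y y'] P Q R QR ne xy x' y' e by auto
    next
      case True
      \<comment> \<open>In a triangle, \<open>P\<close> trades its chosen side for another of its
        edges, leading from \<open>x\<close> or \<open>y\<close> to \<open>v\<close>. Exclusiveness
        of \<open>t Q\<close> and \<open>t R\<close> keeps \<open>v\<close> off the third corner, so
        this edge followed by the other two sides is a rainbow path.\<close>
      obtain v where v: "v \<noteq> x" "v \<noteq> y" "{x, v} \<in> edges P \<or> {y, v} \<in> edges P"
        using adjacent_edge[OF P e(1)] by blast
      from v(3) show False
      proof
        assume h: "{x, v} \<in> edges P"
        then have "v \<noteq> x'" using t(2)[of Q P] x' P Q by auto
        then show False
          using no_rainbow[of P Q R v x x' y] h P Q R QR ne xy x' y' e v True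
          by (auto simp: insert_commute)
      next
        assume h: "{y, v} \<in> edges P"
        then have "v \<noteq> y'" using t(2)[of R P] y' P R by auto
        then show False
          using no_rainbow[of P R Q v y x' x] h P Q R QR ne xy x' y' e v True
          by (auto simp: insert_commute)
      qed
    qed
  qed
  then obtain c l where cl: "\<And>P. P \<in> \<H> \<Longrightarrow> t P = {c P, l P}" "\<And>P. P \<in> \<H> \<Longrightarrow> c P \<noteq> l P"
      "\<And>P Q. \<lbrakk>P \<in> \<H>; Q \<in> \<H>; Q \<noteq> P\<rbrakk> \<Longrightarrow> l P \<notin> t Q"
    by metis
  have "excl P (c P) (l P)" if "P \<in> \<H>" for P
    using t[OF that] cl(1)[OF that] that by (simp add: excl_def)
  moreover have "inj_on l \<H>"
    using cl by (metis inj_onI insertCI)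
  moreover have "c P \<noteq> l Q" if "P \<in> \<H>" "Q \<in> \<H>" for P Q
    using cl that by (metis insertCI)
  ultimately show ?thesis by blast
qed

section \<open>Counting the vertices that are not leaves\<close>

lemma card_verts_ge:
  assumes three: "card \<H> \<ge> 3" and V: "finite V" "\<And>P. P \<in> \<H> \<Longrightarrow> verts P \<subseteq> V"
  shows "card \<H> + 3 \<le> card V"
proof -
  obtain c l where ex: "\<And>P. P \<in> \<H> \<Longrightarrow> excl P (c P) (l P)" and inj: "inj_on l \<H>"
    and cl: "\<And>P Q. \<lbrakk>P \<in> \<H>; Q \<in> \<H>\<rbrakk> \<Longrightarrow> c P \<noteq> l Q"
    using ex_leaf_center by blast
  have lne: "l P \<noteq> l Q" if "P \<in> \<H>" "Q \<in> \<H>" "P \<noteq> Q" for P Q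
    using inj that by (auto simp: inj_on_def)
  have e: "{c P, l P} \<in> edges P" "{l P, c P} \<in> edges P" if "P \<in> \<H>" for P
    using ex[OF that] by (auto dest: exclD)
  have own: "Q = P" if "P \<in> \<H>" "Q \<in> \<H>" "{c P, l P} \<in> edges Q \<or> {l P, c P} \<in> edges Q" for P Q
    using ex that excl_unique by blast
  have inV: "x \<in> V" "y \<in> V" if "P \<in> \<H>" "{x, y} \<in> edges P" for P x y
    using that edge_verts V by blast+
  have third: "\<exists>R \<in> \<H>. R \<noteq> P \<and> R \<noteq> Q" for P Q
  proof (rule ccontr)
    assume "\<not> ?thesis"
    then have "\<H> \<subseteq> {P, Q}" by auto
    then have "card \<H> \<le> card {P, Q}" by (intro card_mono) auto
    also have "\<dots> \<le> 2" by (simp add: card_insert_if)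
    finally show False using three by simp
  qed
  have lV: "l ` \<H> \<subseteq> V" and cV: "c ` \<H> \<subseteq> V - l ` \<H>"
  proof -
    show "l ` \<H> \<subseteq> V"
      using inV(2) e(1) by fast
    have "c P \<in> V" "c P \<notin> l ` \<H>" if "P \<in> \<H>" for P
      using inV(1)[OF that e(1)[OF that]] cl[OF that] by auto
    then show "c ` \<H> \<subseteq> V - l ` \<H>"
      by (intro image_subsetI DiffI)
  qed
  have card_split: "card V = card \<H> + card (V - l ` \<H>)"
    using card_image[OF inj] card_Diff_subset[of "l ` \<H>" V] lV V(1) finite_family
      card_mono[OF V(1) lV] by simp
  have "3 \<le> card (V - l ` \<H>)"
  proof (cases "\<exists>y. \<forall>P \<in> \<H>. c P = y")
    case True
    then obtain y where y: "\<And>P. P \<in> \<H> \<Longrightarrow> c P = y" by blast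
    obtain P where P: "P \<in> \<H>" using third by blast
    \<comment> \<open>Otherwise \<open>l R\<close>, \<open>y\<close>, \<open>l Q\<close>,
      \<open>w\<close> is a rainbow path through \<open>R\<close>, \<open>Q\<close>,
      \<open>P\<close>; here \<open>w\<close> differs from \<open>y\<close> because
      \<open>{y, l Q}\<close> is exclusive to \<open>Q\<close>.\<close>
    have leaf_nbr: "w = l R"
      if "Q \<in> \<H>" "Q \<noteq> P" "R \<in> \<H>" "R \<noteq> P" "R \<noteq> Q" "{l Q, w} \<in> edges P" for Q R w
    proof (rule ccontr)
      assume "w \<noteq> l R"
      moreover have "w \<noteq> y" "w \<noteq> l Q"
        using own[of Q P] y that P edge_neq by (metis, metis)
      ultimately show False
        using no_rainbow[of R Q P "l R" y "l Q" w] that P y cl e lne by force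
    qed
    \<comment> \<open>By \<open>leaf_nbr\<close>, applied also with \<open>Q\<close> and
      \<open>R\<close> exchanged, an edge of \<open>P\<close> at \<open>l Q\<close> would join two
      leaves and be isolated in \<open>P\<close>, which no edge of a path is.\<close>
    have "l Q \<notin> verts P" if Q: "Q \<in> \<H>" "Q \<noteq> P" for Q
    proof
      assume "l Q \<in> verts P"
      then obtain w where w: "{l Q, w} \<in> edges P" using vertex_edge P by blast
      obtain R where R: "R \<in> \<H>" "R \<noteq> P" "R \<noteq> Q" using third by blast
      have QR: "{l Q, l R} \<in> edges P"
        using leaf_nbr[OF Q R w] w by simp
      obtain v where "v \<noteq> l Q" "v \<noteq> l R" "{l Q, v} \<in> edges P \<or> {l R, v} \<in> edges P"
        using adjacent_edge[OF P QR] by blast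
      then show False
        using leaf_nbr Q R by metis
    qed
    then have "verts P - {l P} \<subseteq> V - l ` \<H>"
      using V(2) P by blast
    moreover have "card (verts P - {l P}) = 3"
      using ex_path4[OF P] edge_verts[OF P e(1)[OF P]] by auto
    ultimately show ?thesis
      using V(1) by (metis card_mono finite_Diff)
  next
    case False
    show ?thesis
    proof (rule ccontr)
      assume small: "\<not> ?thesis"
      \<comment> \<open>If all centres were different, they would already be three vertices that are
        not leaves.\<close>
      have "\<exists>y. card {P \<in> \<H>. c P = y} \<ge> 2 \<and> y \<in> c ` \<H>"
      proof (rule ccontr)
        assume no: "\<not> ?thesis"
        have "inj_on c \<H>"
        proof (rule inj_onI, rule ccontr)
          fix P Q assume h: "P \<in> \<H>" "Q \<in> \<H>" "c P = c Q" "P \<noteq> Q"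
          have "card {P, Q} \<le> card {R \<in> \<H>. c R = c P}"
            using finite_family h by (intro card_mono) auto
          then have "2 \<le> card {R \<in> \<H>. c R = c P}"
            using h(4) by simp
          then show False using no h(1) by blast
        qed
        then have "card (c ` \<H>) \<ge> 3"
          using three by (simp add: card_image)
        moreover have "card (c ` \<H>) \<le> card (V - l ` \<H>)"
          using cV V(1) by (intro card_mono) auto
        ultimately show False using small by simp
      qed
      then obtain y where y2: "card {P \<in> \<H>. c P = y} \<ge> 2" and yc: "y \<in> c ` \<H>"
        by blast
      obtain Q where Q: "Q \<in> \<H>" "c Q \<noteq> y" using False by blast
      define z where "z = c Q"
      have yz: "y \<noteq> z" using Q z_def by auto
      have rest: "V - l ` \<H> = {y, z}"
      proof (rule sym, rule card_seteq)
        show "{y, z} \<subseteq> V - l ` \<H>" using cV yc Q z_def by blast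
        show "card (V - l ` \<H>) \<le> card {y, z}" using small yz by simp
      qed (use V(1) in auto)
      \<comment> \<open>The two stars span \<open>V\<close>; every case distinction below is about
        the position of a vertex in them.\<close>
      have cases_V: "v = y \<or> v = z \<or> (\<exists>R \<in> \<H>. v = l R \<and> c R = y) \<or> (\<exists>R \<in> \<H>. v = l R \<and> c R = z)"
        if "v \<in> V" for v
      proof (cases "v \<in> l ` \<H>")
        case True
        then obtain R where R: "R \<in> \<H>" "v = l R" by blast
        then have "c R \<in> {y, z}" using cV rest by blast
        then show ?thesis using R by blast
      next
        case False
        then have "v \<in> {y, z}" using that unfolding rest[symmetric] by simp
        then show ?thesis by blast
      qed
      obtain P P' where P: "P \<in> \<H>" "c P = y" and P': "P' \<in> \<H>" "c P' = y" "P \<noteq> P'"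
      proof -
        obtain T where "T \<subseteq> {P \<in> \<H>. c P = y}" "card T = 2"
          using obtain_subset_with_card_n[OF y2] by blast
        then show ?thesis
          using that by (auto simp: card_2_iff)
      qed
      note ne = yz yz[symmetric]
      have ly: "l R \<noteq> y" "l R \<noteq> z" "y \<noteq> l R" "z \<noteq> l R" if "R \<in> \<H>" for R
        using cl[OF P(1) that] cl[OF Q(1) that] P z_def by auto
      have zQ: "c Q = z" by (simp add: z_def)
      \<comment> \<open>A second edge of \<open>P\<close> at \<open>y\<close>, leading to
        \<open>z\<close> or to a leaf of \<open>z\<close>, is the middle of a rainbow path that
        starts at \<open>l P'\<close> and ends with an edge of the star at \<open>z\<close>. An edge
        to another leaf of \<open>y\<close> is exclusive to another member.\<close>
      have y_end: "w = l P" if w: "{y, w} \<in> edges P" for w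
      proof (rule ccontr)
        assume "w \<noteq> l P"
        have "w \<noteq> y" using edge_neq P w by blast
        from cases_V[of w] inV(2)[OF P(1) w] this
        consider "w = z" | R where "R \<in> \<H>" "w = l R" "c R = y"
          | R where "R \<in> \<H>" "w = l R" "c R = z"
          by blast
        then show False
        proof cases
          case 1
          then show False
            using no_rainbow[of P' P Q "l P'" y z "l Q"] P P' Q zQ ne ly e[of P'] e[of Q]
              lne[of P' Q] w by auto
        next
          case 2
          then show False
            using own[of R P] w P \<open>w \<noteq> l P\<close> by auto
        next
          case 3
          then show False
            using no_rainbow[of P' P R "l P'" y w z] P P' ne ly e[of P'] e[of R]
              lne[of P' R] w by auto
        qed
      qed
      \<comment> \<open>So \<open>y\<close> is an end of \<open>P\<close>. Below, if
        \<open>w\<close> and \<open>x\<close> are leaves of the same star, \<open>P\<close>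
        contributes \<open>{l P, w}\<close> as an outer edge of a rainbow path. Otherwise either
        \<open>{w, x}\<close> is exclusive to another member or \<open>P\<close> contributes it as
        the middle edge.\<close>
      obtain w x where d: "distinct [y, l P, w, x]" and w: "{l P, w} \<in> edges P"
        and x: "{w, x} \<in> edges P"
        using end_edge_extends[of P y "l P"] P e[of P] y_end by blast
      have wx: "{w, l P} \<in> edges P" "{x, w} \<in> edges P"
        using w x by (simp_all add: insert_commute)
      have x_cases: "x = z \<or> (\<exists>S \<in> \<H>. x = l S \<and> c S = y \<and> S \<noteq> P) \<or>
          (\<exists>S \<in> \<H>. x = l S \<and> c S = z \<and> S \<noteq> P)"
        using cases_V[of x] inV(2)[OF P(1) x] d P ne by auto
      from cases_V[of w] inV(2)[OF P(1) w] d
      consider "w = z" | R where "R \<in> \<H>" "w = l R" "c R = y" "R \<noteq> P"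
        | R where "R \<in> \<H>" "w = l R" "c R = z" "R \<noteq> P"
        using P ne by auto
      then show False
      proof cases
        case 1
        with x_cases d consider S where "S \<in> \<H>" "x = l S" "c S = y" "S \<noteq> P"
          | S where "S \<in> \<H>" "x = l S" "c S = z" "S \<noteq> P"
          by auto
        then show False
        proof cases
          case S: 1
          then show False
            using no_rainbow[of S P Q y x z "l Q"] 1 P Q zQ ne ly e[of S] e[of Q]
              lne[of S Q] wx by auto
        next
          case 2
          then show False using own[of S P] 1 P x by auto
        qed
      next
        case R: 2
        from x_cases consider "x = z" | S where "S \<in> \<H>" "x = l S" "c S = y" "S \<noteq> P"
          | S where "S \<in> \<H>" "x = l S" "c S = z" "S \<noteq> P"
          by auto
        then show False
        proof cases
          case 1
          then show False
            using no_rainbow[of R P Q y w z "l Q"] R P Q zQ ne ly e[of R] e[of Q]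
              lne[of R Q] x by auto
        next
          case 2
          then have "S \<noteq> R" using R d by auto
          then show False
            using no_rainbow[of S R P x y w "l P"] 2 R P d e[of R] e[of S] wx by auto
        next
          case 3
          then show False
            using no_rainbow[of R P S y w x z] R P ne ly e[of R] e[of S] d x by auto
        qed
      next
        case R: 3
        from x_cases consider "x = z" | S where "S \<in> \<H>" "x = l S" "c S = y" "S \<noteq> P"
          | S where "S \<in> \<H>" "x = l S" "c S = z" "S \<noteq> P"
          by auto
        then show False
        proof cases
          case 1
          then show False using own[of R P] R P x by auto
        next
          case 2
          then have "S \<noteq> R" using R d by auto
          then show False
            using no_rainbow[of S P R y x w z] 2 R P ne ly e[of R] e[of S] d wx by auto
        next
          case 3
          then have "S \<noteq> R" using R d by auto
          then show False
            using no_rainbow[of P R S "l P" w z x] 3 R P d ne ly e[of R] e[of S] w by auto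
        qed
      qed
    qed
  qed
  then show ?thesis
    using card_split by simp
qed

end

section \<open>Upper bounds for all \<open>n\<close>\<close>

text \<open>All three upper bounds follow: for \<open>n >= 5\<close> the value 2 is at most
  \<open>n - 3\<close>, for \<open>n = 4\<close> the first alternative allows only 1, so that 2
  decides, and for \<open>n <= 3\<close> only 0 is left.\<close>

lemma rb_sizes_path4_cases:
  assumes "k \<in> rb_sizes n (path_graph 4) (path_graph 4)"
  shows "k + 3 \<le> n \<or> k \<le> 2 \<and> 4 \<le> n \<or> k = 0"
proof -
  obtain \<H> and G :: "nat sgraph" where k: "k = card \<H>" and G: "simple_graph G" "card (verts G) = n"
    and sub: "\<H> \<subseteq> copies (path_graph 4) G"
    and nr: "\<forall>C \<in> copies (path_graph 4) G. \<not> rainbow \<H> C"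
    using assms by (auto simp: rb_sizes_def)
  have fin: "finite (verts G)" using G by (simp add: simple_graph_def)
  have subV: "verts P \<subseteq> verts G" if "P \<in> \<H>" for P
    using sub that by (auto simp: copies_def subgraph_def)
  have ed: "edges P \<subseteq> edges G" if "P \<in> \<H>" for P
    using sub that by (auto simp: copies_def subgraph_def)
  show ?thesis
  proof (cases "card \<H> \<ge> 3")
    case True
    interpret rainbow_free_path4s \<H>
    proof
      \<comment> \<open>Infinite sets have cardinality 0.\<close>
      show "finite \<H>" using True by (metis card.infinite not_numeral_le_zero)
      show "\<exists>a b c d. distinct [a, b, c, d] \<and> P = path4 a b c d" if "P \<in> \<H>" for P
        using sub that by (blast elim!: copies_path4E)
      show False if h: "A \<in> \<H>" "B \<in> \<H>" "C \<in> \<H>" "distinct [A, B, C]" "distinct [a, b, c, d]"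
        "{a, b} \<in> edges A" "{b, c} \<in> edges B" "{c, d} \<in> edges C" for A B C a b c d
      proof -
        have es: "{{a, b}, {b, c}, {c, d}} \<subseteq> edges G"
          using h ed by blast
        then have vs: "{a, b, c, d} \<subseteq> verts G"
          using G by (auto simp: simple_graph_def)
        have "path4 a b c d \<in> copies (path_graph 4) G"
          by (rule path4_in_copies[OF h(5) vs es])
        moreover have "rainbow \<H> (path4 a b c d)"
          using h by (intro rainbow_path4I) auto
        ultimately show False using nr by blast
      qed
    qed
    show ?thesis
      using card_verts_ge[OF True fin subV] k G by simp
  next
    case False
    have "4 \<le> n" if nonempty: "card \<H> \<noteq> 0"
    proof -
      obtain P where P: "P \<in> \<H>" using nonempty by fastforce
      then obtain a b c d where "distinct [a, b, c, d]" "P = path4 a b c d"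
        using sub by (blast elim!: copies_path4E)
      then have "card (verts P) = 4" by simp
      then show ?thesis
        using card_mono[OF fin subV[OF P]] G by simp
    qed
    then show ?thesis using False k by auto
  qed
qed

section \<open>Extremal families\<close>

text \<open>Both edges at a vertex \<open>i >= 3\<close> lie in \<open>M i\<close> alone, so such a
  vertex is never inner on a rainbow path. The middle edge would have to be \<open>{0, 2}\<close>,
  but 2 has no other neighbour in the host.\<close>

lemma n_minus_3_in_rb_sizes:
  assumes "n \<ge> 3"
  shows "n - 3 \<in> rb_sizes n (path_graph 4) (path_graph 4)"
proof -
  define M where "M i = path4 2 0 i 1" for i :: nat
  define \<H> where "\<H> = M ` {3..<n}"
  define G where "G = \<lparr>verts = {..<n}, edges = \<Union> (edges ` \<H>)\<rparr>"
  have "inj_on M {3..<n}"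
  proof (rule inj_onI)
    fix i j assume ij: "i \<in> {3..<n}" "j \<in> {3..<n}" "M i = M j"
    then have "verts (M i) = verts (M j)"
      by simp
    then have "i \<in> {2, 0, j, 1}"
      unfolding M_def path4_sel by blast
    then show "i = j"
      using ij by auto
  qed
  then have card: "card \<H> = n - 3"
    by (simp add: \<H>_def card_image)
  have simple: "simple_graph G"
    by (auto simp: simple_graph_def G_def \<H>_def M_def card_insert_if)
  have "M i \<in> copies (path_graph 4) G" if "i \<in> {3..<n}" for i
    unfolding M_def using that
    by (intro path4_in_copies) (force simp: G_def \<H>_def M_def)+
  then have sub: "\<H> \<subseteq> copies (path_graph 4) G"
    by (auto simp: \<H>_def)
  have "\<not> rainbow \<H> C" if copy: "C \<in> copies (path_graph 4) G" for C
  proof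
    assume rb: "rainbow \<H> C"
    obtain a b c d where d: "distinct [a, b, c, d]" and C: "C = path4 a b c d"
      using copies_path4E[OF copy] .
    obtain A B D where ABD: "distinct [A, B, D]" "{A, B, D} \<subseteq> \<H>"
      "{a, b} \<in> edges A" "{b, c} \<in> edges B" "{c, d} \<in> edges D"
      using rainbow_path4E[OF rb[unfolded C] d] .
    obtain i j k where "A = M i" "B = M j" "D = M k" "i \<ge> 3" "j \<ge> 3" "k \<ge> 3"
      using ABD(2) by (auto simp: \<H>_def)
    moreover from this ABD(1) have "i \<noteq> j" "j \<noteq> k"
      by auto
    ultimately have "i \<ge> 3" "j \<ge> 3" "k \<ge> 3" "i \<noteq> j" "j \<noteq> k"
      "{a, b} \<in> edges (M i)" "{b, c} \<in> edges (M j)" "{c, d} \<in> edges (M k)"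
      using ABD by simp_all
    then show False
      using d by (auto simp: M_def doubleton_eq_iff)
  qed
  then show ?thesis
    unfolding rb_sizes_def using card simple sub
    by (intro CollectI exI[of _ \<H>] exI[of _ G]) (auto simp: G_def)
qed

text \<open>Three edges cannot be mapped injectively to two members, so any two copies in the
  complete graph would do. The general construction gives only one path on four vertices.\<close>

lemma two_in_rb_sizes: "2 \<in> rb_sizes 4 (path_graph 4) (path_graph 4)"
proof -
  define G where "G = \<lparr>verts = {..<4::nat}, edges = {e. e \<subseteq> {..<4} \<and> card e = 2}\<rparr>"
  define \<H> where "\<H> = {path4 0 1 2 3, path4 0 1 3 (2::nat)}"
  have "\<H> \<subseteq> copies (path_graph 4) G"
    by (auto simp: \<H>_def G_def intro!: path4_in_copies)
  moreover have "card \<H> = 2"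
  proof -
    have "{1, 2} \<in> edges (path4 0 1 2 (3::nat))" "{1, 2} \<notin> edges (path4 0 1 3 (2::nat))"
      by (auto simp: doubleton_eq_iff)
    then have "path4 0 1 2 3 \<noteq> path4 0 1 3 (2::nat)"
      by metis
    then show ?thesis
      by (simp add: \<H>_def)
  qed
  moreover have "\<not> rainbow \<H> C" if C: "C \<in> copies (path_graph 4) G" for C
  proof
    assume "rainbow \<H> C"
    then obtain a b c d A B D where "distinct [A, B, D]" "{A, B, D} \<subseteq> \<H>"
      using copies_path4E[OF C] rainbow_path4E by metis
    then show False by (auto simp: \<H>_def)
  qed
  ultimately show ?thesis
    unfolding rb_sizes_def
    by (intro CollectI exI[of _ \<H>] exI[of _ G]) (auto simp: G_def simple_graph_def)
qed

theorem theorem4p5: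
  fixes n :: nat
  assumes "n \<ge> 1"
  shows "(n \<ge> 5 \<longrightarrow> rb n (path_graph 4) (path_graph 4) = n - 3) \<and>
         rb 4 (path_graph 4) (path_graph 4) = 2 \<and>
         (n \<le> 3 \<longrightarrow> rb n (path_graph 4) (path_graph 4) = 0)"
proof (intro conjI impI)
  show "rb n (path_graph 4) (path_graph 4) = n - 3" if "n \<ge> 5"
    unfolding rb_def using that rb_sizes_path4_cases n_minus_3_in_rb_sizes
    by (intro Max_eqI finite_rb_sizes) fastforce+
  show "rb 4 (path_graph 4) (path_graph 4) = 2"
    unfolding rb_def using rb_sizes_path4_cases two_in_rb_sizes
    by (intro Max_eqI finite_rb_sizes) fastforce+
  show "rb n (path_graph 4) (path_graph 4) = 0" if "n \<le> 3"
  proof -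
    have "simple_graph (path_graph 4)" "edges (path_graph 4) \<noteq> {}"
      by (auto simp: path_graph_4 simple_graph_def)
    \<comment> \<open>The maximum is itself a size, and every size is 0 here, so no family has to be
      exhibited.\<close>
    then have "rb n (path_graph 4) (path_graph 4) \<in> rb_sizes n (path_graph 4) (path_graph 4)"
      unfolding rb_def by (intro Max_in finite_rb_sizes rb_sizes_nonempty)
    then show ?thesis
      using rb_sizes_path4_cases that by fastforce
  qed
qed

end
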